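(* Let $(X,d)$ be an infinite metric space and let $\mathfrak{B}$ be a bornology on $X$ with a closed base such that $X\notin\mathfrak{B}$. The following statements are equivalent. (1) ONE has a winning strategy in $\mathcal{O}_{\mathfrak{B}^s}(X)$. (2) ONE has a winning strategy in $\Gamma_{\mathfrak{B}^s}(X)$. (3) TWO has a winning strategy in $\mathsf{G}_1(\mathcal{O}_{\mathfrak{B}^s},\mathcal{O}_{\mathfrak{B}^s})$ on $X$. (4) TWO has a winning strategy in $\mathsf{G}_1(\mathcal{O}_{\mathfrak{B}^s},\Gamma_{\mathfrak{B}^s})$ on $X$.
   Context: A bornology on a set $X$ is a family $\mathfrak{B}$ of subsets of $X$ that covers $X$, is closed under finite unions and is closed under taking subsets. A base of $\mathfrak{B}$ is a subfamily $\mathfrak{B}_0\subseteq\mathfrak{B}$ such that every $B\in\mathfrak{B}$ is contained in some $B_0\in\mathfrak{B}_0$; it is a closed base if all its members are closed in $X$. For $B\subseteq X$ and $\delta>0$, $B^\delta=\bigcup_{x\in B}\{y\in X: d(x,y)<\delta\}$. An open $\mathfrak{B}^s$-cover of $X$ is a family $\mathcal{U}$ of open subsets of $X$ that covers $X$ with $X\notin\mathcal{U}$ such that for every $B\in\mathfrak{B}$ there are $U\in\mathcal{U}$ and $\delta>0$ with $B^\delta\subseteq U$; $\mathcal{O}_{\mathfrak{B}^s}$ is the collection of all of them. A $\gamma_{\mathfrak{B}^s}$-cover of $X$ is an open cover $\{U_n:n\in\mathbb{N}\}$, infinite and not containing $X$ as a member, such that for every $B\in\mathfrak{B}$ there are $n_0\in\mathbb{N}$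 and positive reals $\delta_n$ ($n\ge n_0$) with $B^{\delta_n}\subseteq U_n$ for all $n\ge n_0$; $\Gamma_{\mathfrak{B}^s}$ is the collection of all of them. In the games $\mathcal{O}_{\mathfrak{B}^s}(X)$ and $\Gamma_{\mathfrak{B}^s}(X)$, in each round $n\in\mathbb{N}$ ONE chooses $B_n\in\mathfrak{B}$ and TWO responds with an open set $U_n\ne X$ such that $B_n^{\delta_n}\subseteq U_n$ for some $\delta_n>0$. In $\mathcal{O}_{\mathfrak{B}^s}(X)$ ONE wins if $\{U_n:n\in\mathbb{N}\}$ is an open $\mathfrak{B}^s$-cover of $X$; in $\Gamma_{\mathfrak{B}^s}(X)$ ONE wins if $\{U_n:n\in\mathbb{N}\}$ is a $\gamma_{\mathfrak{B}^s}$-cover of $X$. Otherwise TWO wins. In the game $\mathsf{G}_1(\mathcal{A},\mathcal{C})$, in each round $n$ ONE chooses $A_n\in\mathcal{A}$ and TWO responds with $b_n\in A_n$; TWO wins if $\{b_n:n\in\mathbb{N}\}\in\mathcal{C}$, otherwise ONE wins. Strategies are with full memory of the opponent's moves so far. *)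

theory Defs
  imports "HOL-Analysis.Analysis"
begin

text \<open>The metric space \<open>X\<close> is the whole type \<open>'a::metric_space\<close>, so that \<open>X = UNIV\<close>.\<close>

definition bornology :: "'a set set \<Rightarrow> bool" where
  "bornology \<BB> \<longleftrightarrow>
     \<Union>\<BB> = UNIV \<and>
     (\<forall>A\<in>\<BB>. \<forall>B\<in>\<BB>. A \<union> B \<in> \<BB>) \<and>
     (\<forall>B\<in>\<BB>. \<forall>A. A \<subseteq> B \<longrightarrow> A \<in> \<BB>)"

definition bornology_base :: "'a set set \<Rightarrow> 'a set set \<Rightarrow> bool" where
  "bornology_base \<BB>0 \<BB> \<longleftrightarrow> \<BB>0 \<subseteq> \<BB> \<and> (\<forall>B\<in>\<BB>. \<exists>B0\<in>\<BB>0. B \<subseteq> B0)"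

definition has_closed_base :: "'a::topological_space set set \<Rightarrow> bool" where
  "has_closed_base \<BB> \<longleftrightarrow> (\<exists>\<BB>0. bornology_base \<BB>0 \<BB> \<and> (\<forall>B\<in>\<BB>0. closed B))"

definition enlargement :: "'a::metric_space set \<Rightarrow> real \<Rightarrow> 'a set" where
  "enlargement B \<delta> = (\<Union>x\<in>B. {y. dist x y < \<delta>})"

definition open_cover :: "'a::topological_space set set \<Rightarrow> bool" where
  "open_cover \<U> \<longleftrightarrow> (\<forall>U\<in>\<U>. open U) \<and> \<Union>\<U> = UNIV"

definition open_Bs_covers :: "'a::metric_space set set \<Rightarrow> 'a set set set" where
  "open_Bs_covers \<BB> =
     {\<U>. open_cover \<U> \<and> UNIV \<notin> \<U> \<and>
         (\<forall>B\<in>\<BB>. \<exists>U\<in>\<U>. \<exists>\<delta>>0. enlargement B \<delta> \<subseteq> U)}"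

text \<open>Being a \<open>\<gamma>\<close>-cover is a property of the family \<open>\<U>\<close> itself; the sequence \<open>U\<close> below is any
  enumeration of it (repetitions allowed), while \<open>\<U>\<close> as a set of sets has to be infinite.\<close>

definition gamma_Bs_covers :: "'a::metric_space set set \<Rightarrow> 'a set set set" where
  "gamma_Bs_covers \<BB> =
     {\<U>. open_cover \<U> \<and> infinite \<U> \<and> UNIV \<notin> \<U> \<and>
         (\<exists>U :: nat \<Rightarrow> 'a set. \<U> = range U \<and>
            (\<forall>B\<in>\<BB>. \<exists>n0. \<exists>\<delta> :: nat \<Rightarrow> real. \<forall>n\<ge>n0. \<delta> n > 0 \<and> enlargement B (\<delta> n) \<subseteq> U n))}"

definition legal_response :: "'a::metric_space set \<Rightarrow> 'a set \<Rightarrow> bool" where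
  "legal_response B U \<longleftrightarrow> open U \<and> U \<noteq> UNIV \<and> (\<exists>\<delta>>0. enlargement B \<delta> \<subseteq> U)"

text \<open>The game in which ONE plays \<open>B\<^sub>n \<in> \<BB>\<close>, TWO answers with a legal \<open>U\<^sub>n\<close>, and ONE wins iff
  \<open>{U\<^sub>n : n \<in> \<nat>} \<in> \<C>\<close>. A strategy of ONE maps the list of the previous moves
  \<open>[U\<^sub>0, \<dots>, U\<^sub>n\<^sub>-\<^sub>1]\<close> of TWO to \<open>B\<^sub>n\<close>; the earlier moves of ONE need not be recorded because the
  strategy determines them.\<close>

definition ONE_wins_Bs_game :: "'a::metric_space set set \<Rightarrow> 'a set set set \<Rightarrow> bool" where
  "ONE_wins_Bs_game \<BB> \<C> \<longleftrightarrow>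
     (\<exists>\<sigma> :: 'a set list \<Rightarrow> 'a set.
        (\<forall>h. \<sigma> h \<in> \<BB>) \<and>
        (\<forall>U :: nat \<Rightarrow> 'a set.
           (\<forall>n. legal_response (\<sigma> (map U [0..<n])) (U n)) \<longrightarrow> range U \<in> \<C>))"

abbreviation ONE_wins_O_game :: "'a::metric_space set set \<Rightarrow> bool" where
  "ONE_wins_O_game \<BB> \<equiv> ONE_wins_Bs_game \<BB> (open_Bs_covers \<BB>)"

abbreviation ONE_wins_Gamma_game :: "'a::metric_space set set \<Rightarrow> bool" where
  "ONE_wins_Gamma_game \<BB> \<equiv> ONE_wins_Bs_game \<BB> (gamma_Bs_covers \<BB>)"

text \<open>A strategy of TWO in \<open>G\<^sub>1(\<A>, \<C>)\<close> maps the list \<open>[A\<^sub>0, \<dots>, A\<^sub>n]\<close> of all moves of ONE up to and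
  including the current one to \<open>b\<^sub>n \<in> A\<^sub>n\<close>.\<close>

definition TWO_wins_G1 :: "'b set set \<Rightarrow> 'b set set \<Rightarrow> bool" where
  "TWO_wins_G1 \<A> \<C> \<longleftrightarrow>
     (\<exists>\<tau> :: 'b set list \<Rightarrow> 'b.
        (\<forall>h A. set h \<subseteq> \<A> \<and> A \<in> \<A> \<longrightarrow> \<tau> (h @ [A]) \<in> A) \<and>
        (\<forall>A :: nat \<Rightarrow> 'b set.
           (\<forall>n. A n \<in> \<A>) \<longrightarrow> range (\<lambda>n. \<tau> (map A [0..<Suc n])) \<in> \<C>))"

end

theory Submission
  imports Defs
begin

text \<open>
  For every class \<open>\<C>\<close>, the game in which ONE plays sets from \<open>\<BB>\<close> and aims at \<open>\<C>\<close> is dual to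
  \<open>G\<^sub>1(\<O>, \<C>)\<close>. A set \<open>B\<close> played by ONE prescribes to TWO a choice from any \<open>\<BB>\<^sup>s\<close>-cover, so ONE's strategy
  steers TWO in \<open>G\<^sub>1\<close>. Conversely, after each history of \<open>G\<^sub>1\<close> there is a \<open>B \<in> \<BB>\<close> all of whose legal
  responses are answers of TWO's strategy to some cover: otherwise the responses that are
  never given, one for each \<open>B\<close>, would form a cover to which TWO has no answer.

  To pass from \<open>\<BB>\<^sup>s\<close>-covers to \<open>\<gamma>\<close>-covers, ONE plays at each round the union of the sets that the
  given strategy proposes for all words formed from TWO's moves so far, of at most the current
  length. Then every subsequence of TWO's moves is a legal play against the given strategy, so
  each subsequence is a \<open>\<BB>\<^sup>s\<close>-cover.
\<close>

lemma legal_response_mono: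
  "legal_response B U \<Longrightarrow> A \<subseteq> B \<Longrightarrow> legal_response A U"
  unfolding legal_response_def enlargement_def by (meson UN_mono order_trans subset_refl)

lemma bornology_covers:
  assumes "bornology \<BB>"
  obtains B where "B \<in> \<BB>" "x \<in> B"
proof -
  have "x \<in> \<Union>\<BB>"
    using assms by (simp add: bornology_def)
  then show ?thesis
    using that by (elim UnionE)
qed

text \<open>Covering comes for free: each point lies in some \<open>B\<close> of the bornology, and
  \<open>B\<close> lies in each of its enlargements. Covers can thus be handled purely through legal
  responses.\<close>

lemma open_Bs_covers_iff_legal:
  assumes "bornology \<BB>"
  shows "\<U> \<in> open_Bs_covers \<BB> \<longleftrightarrow>
    (\<forall>U\<in>\<U>. open U \<and> U \<noteq> UNIV) \<and> (\<forall>B\<in>\<BB>. \<exists>U\<in>\<U>. legal_response B U)"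
proof -
  have "open_cover \<U>" if opn: "\<forall>U\<in>\<U>. open U" and legal: "\<forall>B\<in>\<BB>. \<exists>U\<in>\<U>. legal_response B U"
  proof -
    have "x \<in> \<Union>\<U>" for x
    proof -
      obtain B where B: "B \<in> \<BB>" "x \<in> B"
        using bornology_covers[OF assms] .
      then obtain U where "U \<in> \<U>" "legal_response B U"
        using legal by blast
      then obtain \<delta> where "\<delta> > 0" "enlargement B \<delta> \<subseteq> U"
        unfolding legal_response_def by metis
      moreover have "x \<in> enlargement B \<delta>"
        unfolding enlargement_def using B(2) \<open>\<delta> > 0\<close> by (intro UN_I[of x]) auto
      ultimately show ?thesis
        using \<open>U \<in> \<U>\<close> by blast
    qed
    then show ?thesis
      using opn unfolding open_cover_def by blast
  qed
  moreover have "(\<forall>U\<in>\<U>. open U) \<and> UNIV \<notin> \<U> \<longleftrightarrow> (\<forall>U\<in>\<U>. open U \<and> U \<noteq> UNIV)"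
    by metis
  moreover have "(\<exists>U\<in>\<U>. \<exists>\<delta>>0. enlargement B \<delta> \<subseteq> U) \<longleftrightarrow> (\<exists>U\<in>\<U>. legal_response B U)"
    if "\<forall>U\<in>\<U>. open U \<and> U \<noteq> UNIV" for B
    using that unfolding legal_response_def by (intro bex_cong) auto
  moreover have "open_cover \<U> \<Longrightarrow> \<forall>U\<in>\<U>. open U"
    by (simp add: open_cover_def)
  ultimately show ?thesis
    unfolding open_Bs_covers_def mem_Collect_eq by (smt (verit))
qed

lemma gamma_Bs_covers_subset:
  fixes \<BB> :: "'a::metric_space set set"
  shows "gamma_Bs_covers \<BB> \<subseteq> open_Bs_covers \<BB>"
proof
  fix \<U>
  assume \<U>: "\<U> \<in> gamma_Bs_covers \<BB>"
  then obtain U :: "nat \<Rightarrow> 'a set" where U: "\<U> = range U"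
    "\<And>B. B \<in> \<BB> \<Longrightarrow> \<exists>n0 \<delta>. \<forall>n\<ge>n0. \<delta> n > 0 \<and> enlargement B (\<delta> n) \<subseteq> U n"
    unfolding gamma_Bs_covers_def by auto
  have "\<exists>U\<in>\<U>. \<exists>\<delta>>0. enlargement B \<delta> \<subseteq> U" if "B \<in> \<BB>" for B
    using U(2)[OF that] unfolding U(1) by (metis order_refl rangeI)
  then show "\<U> \<in> open_Bs_covers \<BB>"
    using \<U> unfolding gamma_Bs_covers_def open_Bs_covers_def by simp
qed

lemma bornology_finite_Union:
  assumes "bornology \<BB>" "finite F" "F \<subseteq> \<BB>"
  shows "\<Union>F \<in> \<BB>"
  using assms(2,3)
proof (induction F rule: finite_induct)
  case empty
  obtain B where "B \<in> \<BB>"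
    using bornology_covers[OF assms(1)] .
  then show ?case
    using assms(1) unfolding bornology_def by (metis Union_empty empty_subsetI)
next
  case (insert A F)
  then show ?case
    using assms(1) unfolding bornology_def by simp
qed

text \<open>Strategies see only the opponent's moves, while a translation between the two games
  needs one's own earlier moves. This recomputes them: \<open>f\<close> takes the replies given so
  far and the current move.\<close>

definition replies :: "('b list \<Rightarrow> 'a \<Rightarrow> 'b) \<Rightarrow> 'a list \<Rightarrow> 'b list" where
  "replies f = foldl (\<lambda>ys x. ys @ [f ys x]) []"

lemma replies_snoc: "replies f (xs @ [x]) = replies f xs @ [f (replies f xs) x]"
  by (simp add: replies_def)

lemma map_replies:
  assumes "\<And>n. b n = f (replies f (map a [0..<n])) (a n)"
  shows "map b [0..<n] = replies f (map a [0..<n])"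
proof (induction n)
  case 0
  then show ?case by (simp add: replies_def)
next
  case (Suc n)
  then show ?case by (simp add: replies_snoc assms)
qed

lemma TWO_wins_G1_if_ONE_wins_Bs_game:
  assumes "bornology \<BB>" "ONE_wins_Bs_game \<BB> \<C>"
  shows "TWO_wins_G1 (open_Bs_covers \<BB>) \<C>"
proof -
  let ?O = "open_Bs_covers \<BB>"
  obtain \<sigma> where \<sigma>: "\<And>h. \<sigma> h \<in> \<BB>"
    and win: "\<And>U. (\<And>n. legal_response (\<sigma> (map U [0..<n])) (U n)) \<Longrightarrow> range U \<in> \<C>"
    using assms(2) unfolding ONE_wins_Bs_game_def by metis
  have "\<forall>us A. \<exists>U. A \<in> ?O \<longrightarrow> U \<in> A \<and> legal_response (\<sigma> us) U"
    using \<sigma> open_Bs_covers_iff_legal[OF assms(1)] by blast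
  then obtain f where f: "\<And>us A. A \<in> ?O \<Longrightarrow> f us A \<in> A \<and> legal_response (\<sigma> us) (f us A)"
    by metis
  \<comment> \<open>The history given to TWO in \<open>G\<^sub>1\<close> includes the current cover,
    so the answer to it is the last reply.\<close>
  define \<tau> where "\<tau> h = last (replies f h)" for h
  have \<tau>_snoc: "\<tau> (h @ [A]) = f (replies f h) A" for h A
    by (simp add: \<tau>_def replies_snoc)
  have "range (\<lambda>n. \<tau> (map A [0..<Suc n])) \<in> \<C>" if A: "\<And>n. A n \<in> ?O" for A
  proof (rule win)
    fix n
    have "map (\<lambda>n. \<tau> (map A [0..<Suc n])) [0..<n] = replies f (map A [0..<n])"
      by (rule map_replies) (simp add: \<tau>_snoc)
    then show "legal_response (\<sigma> (map (\<lambda>n. \<tau> (map A [0..<Suc n])) [0..<n])) (\<tau> (map A [0..<Suc n]))"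
      using f A by (simp add: \<tau>_snoc)
  qed
  then show ?thesis
    unfolding TWO_wins_G1_def using f \<tau>_snoc by (intro exI[of _ \<tau>]) auto
qed

lemma ex_all_legal_responses_attained:
  assumes "bornology \<BB>"
    and "\<And>A. A \<in> open_Bs_covers \<BB> \<Longrightarrow> t A \<in> A"
  shows "\<exists>B\<in>\<BB>. \<forall>U. legal_response B U \<longrightarrow> (\<exists>A\<in>open_Bs_covers \<BB>. t A = U)"
proof (rule ccontr)
  assume "\<not> ?thesis"
  then obtain V where V: "\<And>B. B \<in> \<BB> \<Longrightarrow> legal_response B (V B)"
    "\<And>A B. B \<in> \<BB> \<Longrightarrow> A \<in> open_Bs_covers \<BB> \<Longrightarrow> t A \<noteq> V B"
    by metis
  have "V ` \<BB> \<in> open_Bs_covers \<BB>"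
    unfolding open_Bs_covers_iff_legal[OF assms(1)]
  proof (intro conjI)
    show "\<forall>U\<in>V ` \<BB>. open U \<and> U \<noteq> UNIV"
      using V(1) by (simp add: legal_response_def)
    show "\<forall>B\<in>\<BB>. \<exists>U\<in>V ` \<BB>. legal_response B U"
      using V(1) by blast
  qed
  \<comment> \<open>The member that \<open>t\<close> picks from this cover is some
    \<open>V B\<close>, which \<open>V\<close> was chosen to avoid.\<close>
  then show False
    using assms(2) V(2) by blast
qed

lemma ONE_wins_Bs_game_if_TWO_wins_G1:
  assumes "bornology \<BB>" "TWO_wins_G1 (open_Bs_covers \<BB>) \<C>"
  shows "ONE_wins_Bs_game \<BB> \<C>"
proof -
  let ?O = "open_Bs_covers \<BB>"
  obtain \<tau> where \<tau>: "\<And>h A. set h \<subseteq> ?O \<Longrightarrow> A \<in> ?O \<Longrightarrow> \<tau> (h @ [A]) \<in> A"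
    and win: "\<And>A. (\<And>n. A n \<in> ?O) \<Longrightarrow> range (\<lambda>n. \<tau> (map A [0..<Suc n])) \<in> \<C>"
    using assms(2) unfolding TWO_wins_G1_def by metis
  have "\<exists>B\<in>\<BB>. set h \<subseteq> ?O \<longrightarrow> (\<forall>U. legal_response B U \<longrightarrow> (\<exists>A\<in>?O. \<tau> (h @ [A]) = U))" for h
  proof (cases "set h \<subseteq> ?O")
    case True
    then show ?thesis
      using ex_all_legal_responses_attained[OF assms(1), of "\<lambda>A. \<tau> (h @ [A])"] \<tau> by blast
  next
    \<comment> \<open>Any member of \<BB> serves as a default here; such histories never occur in
      the plays below.\<close>
    case False
    then show ?thesis
      using bornology_covers[OF assms(1)] by meson
  qed
  then obtain K where K: "\<And>h. K h \<in> \<BB>"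
    "\<And>h U. set h \<subseteq> ?O \<Longrightarrow> legal_response (K h) U \<Longrightarrow> \<exists>A\<in>?O. \<tau> (h @ [A]) = U"
    by metis
  then obtain F where F: "\<And>h U. set h \<subseteq> ?O \<Longrightarrow> legal_response (K h) U \<Longrightarrow>
      F h U \<in> ?O \<and> \<tau> (h @ [F h U]) = U"
    by metis
  \<comment> \<open>\<open>F\<close> turns TWO's open sets into covers to which \<tau> answers with
    exactly those sets; \<open>K\<close> then reads this simulated history of
    \<open>G\<^sub>1\<close>.\<close>
  define \<sigma> where "\<sigma> us = K (replies F us)" for us
  have "range U \<in> \<C>" if legal: "\<And>n. legal_response (\<sigma> (map U [0..<n])) (U n)" for U
  proof -
    define A where "A n = F (replies F (map U [0..<n])) (U n)" for n
    have replies_eq: "replies F (map U [0..<n]) = map A [0..<n]" for n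
      by (rule map_replies[symmetric]) (simp add: A_def)
    have A_eq: "A n = F (map A [0..<n]) (U n)" for n
      using A_def[of n] unfolding replies_eq .
    have legal': "legal_response (K (map A [0..<n])) (U n)" for n
      using legal[of n] by (simp add: \<sigma>_def replies_eq)
    \<comment> \<open>Strong induction, since \<open>F\<close> is controlled only on histories that
      consist of covers.\<close>
    have A_in: "A n \<in> ?O" for n
    proof (induction n rule: less_induct)
      case (less n)
      then have "set (map A [0..<n]) \<subseteq> ?O" by auto
      then show ?case using F legal' A_eq by metis
    qed
    then have "set (map A [0..<n]) \<subseteq> ?O" for n by auto
    then have "\<tau> (map A [0..<Suc n]) = U n" for n
      using F legal' A_eq[of n] by simp
    then show ?thesis using win[of A] A_in by simp
  qed
  then show ?thesis
    unfolding ONE_wins_Bs_game_def using K(1) \<sigma>_def by (intro exI[of _ \<sigma>]) auto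
qed

text \<open>If \<open>U n\<close> fails to be legal for \<open>B\<close> infinitely often, those
  indices give a subsequence that is not a cover for \<open>B\<close>. If the range were finite,
  some constant subsequence would be a cover by one set, which would have to be the whole
  space.\<close>

lemma gamma_Bs_cover_if_subsequences:
  assumes "bornology \<BB>"
    and sub: "\<And>r :: nat \<Rightarrow> nat. strict_mono r \<Longrightarrow> range (U \<circ> r) \<in> open_Bs_covers \<BB>"
  shows "range U \<in> gamma_Bs_covers \<BB>"
proof -
  have U: "range U \<in> open_Bs_covers \<BB>"
    using sub[of id] by (simp add: strict_mono_def)
  have sub_in: "\<exists>n\<in>S. legal_response B (U n)" if "infinite S" "B \<in> \<BB>" for S B
    using sub[OF strict_mono_enumerate[OF that(1)]] that enumerate_in_set[OF that(1)]
    unfolding open_Bs_covers_iff_legal[OF assms(1)] by fastforce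
  have "infinite (range U)"
  proof
    assume "finite (range U)"
    then obtain m where inf: "infinite {n. U n = U m}"
      using pigeonhole_infinite[of UNIV U] by auto
    have "range (U \<circ> enumerate {n. U n = U m}) = {U m}"
      using enumerate_in_set[OF inf] by auto
    then have "{U m} \<in> open_Bs_covers \<BB>"
      using sub[OF strict_mono_enumerate[OF inf]] by simp
    then show False
      unfolding open_Bs_covers_def open_cover_def by auto
  qed
  moreover have "\<exists>n0. \<exists>\<delta>. \<forall>n\<ge>n0. \<delta> n > 0 \<and> enlargement B (\<delta> n) \<subseteq> U n" if "B \<in> \<BB>" for B
  proof -
    have "finite {n. \<not> legal_response B (U n)}"
      using sub_in[OF _ that] by blast
    then obtain n0 where "\<And>n. n \<ge> n0 \<Longrightarrow> legal_response B (U n)"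
      by (metis (mono_tags, lifting) finite_nat_set_iff_bounded mem_Collect_eq not_less)
    then show ?thesis
      unfolding legal_response_def by metis
  qed
  ultimately show ?thesis
    using U unfolding gamma_Bs_covers_def open_Bs_covers_def by blast
qed

lemma ONE_wins_Gamma_game_if_ONE_wins_O_game:
  assumes "bornology \<BB>" "ONE_wins_O_game \<BB>"
  shows "ONE_wins_Gamma_game \<BB>"
proof -
  obtain \<sigma> where \<sigma>: "\<And>h. \<sigma> h \<in> \<BB>"
    and win: "\<And>U. (\<And>n. legal_response (\<sigma> (map U [0..<n])) (U n)) \<Longrightarrow> range U \<in> open_Bs_covers \<BB>"
    using assms(2) unfolding ONE_wins_Bs_game_def by metis
  \<comment> \<open>Only finitely many words \<open>g\<close> qualify, so the union stays in
    \<BB>.\<close>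
  define \<sigma>' where "\<sigma>' h = \<Union>(\<sigma> ` {g. set g \<subseteq> set h \<and> length g \<le> length h})" for h
  have "\<sigma>' h \<in> \<BB>" for h
    unfolding \<sigma>'_def using \<sigma>
    by (intro bornology_finite_Union[OF assms(1)]) (auto intro: finite_lists_length_le)
  moreover have "range U \<in> gamma_Bs_covers \<BB>"
    if legal: "\<And>n. legal_response (\<sigma>' (map U [0..<n])) (U n)" for U
  proof (intro gamma_Bs_cover_if_subsequences[OF assms(1)] win)
    fix r :: "nat \<Rightarrow> nat" and n
    assume r: "strict_mono r"
    \<comment> \<open>The first \<open>n\<close> terms of the subsequence have indices below
      \<open>r n\<close>, and \<open>n \<le> r n\<close>; so they form one of the words considered
      in round \<open>r n\<close>.\<close>
    have "set (map (U \<circ> r) [0..<n]) \<subseteq> set (map U [0..<r n])"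
      using r by (auto simp: strict_mono_less)
    then have "\<sigma> (map (U \<circ> r) [0..<n]) \<subseteq> \<sigma>' (map U [0..<r n])"
      unfolding \<sigma>'_def using strict_mono_imp_increasing[OF r, of n] by (intro Union_upper imageI) simp
    then show "legal_response (\<sigma> (map (U \<circ> r) [0..<n])) ((U \<circ> r) n)"
      using legal_response_mono[OF legal[of "r n"]] by simp
  qed
  ultimately show ?thesis
    unfolding ONE_wins_Bs_game_def by blast
qed

theorem theorem5p2:
  fixes \<BB> :: "'a::metric_space set set"
  assumes "infinite (UNIV :: 'a set)"
    and "bornology \<BB>"
    and "has_closed_base \<BB>"
    and "UNIV \<notin> \<BB>"
  shows "(ONE_wins_O_game \<BB> \<longleftrightarrow> ONE_wins_Gamma_game \<BB>) \<and>
         (ONE_wins_Gamma_game \<BB> \<longleftrightarrow> TWO_wins_G1 (open_Bs_covers \<BB>) (open_Bs_covers \<BB>)) \<and>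
         (TWO_wins_G1 (open_Bs_covers \<BB>) (open_Bs_covers \<BB>) \<longleftrightarrow>
            TWO_wins_G1 (open_Bs_covers \<BB>) (gamma_Bs_covers \<BB>))"
proof -
  have duality: "ONE_wins_Bs_game \<BB> \<C> \<longleftrightarrow> TWO_wins_G1 (open_Bs_covers \<BB>) \<C>" for \<C>
    using TWO_wins_G1_if_ONE_wins_Bs_game[OF assms(2)] ONE_wins_Bs_game_if_TWO_wins_G1[OF assms(2)]
    by blast
  have "ONE_wins_O_game \<BB>" if "ONE_wins_Gamma_game \<BB>"
    using that gamma_Bs_covers_subset unfolding ONE_wins_Bs_game_def by blast
  then have "ONE_wins_O_game \<BB> \<longleftrightarrow> ONE_wins_Gamma_game \<BB>"
    using ONE_wins_Gamma_game_if_ONE_wins_O_game[OF assms(2)] by blast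
  then show ?thesis
    \<comment> \<open>Duality for both classes of covers carries the equivalence of ONE's two games
      over to TWO's.\<close>
    using duality by blast
qed

end
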